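(* Assume that for every nonempty $S\subseteq\mathcal U$ there exists $x\in S$ with $|\mathcal N_x\cap S|\le1$, and that $|\mathcal N_x|=2d$ for every $x\in\mathcal U$. Let $g\colon\mathcal O\to\mathbb R$, and let $b$, $B$, $\|\cdot\|_b$ be the barrier function, its maximum on $\mathcal U$, and the associated norm, as defined in the context. Then $$\|T_0[u]-T_0[v]\|_b\le\Bigl(1-\frac1B\Bigr)\|u-v\|_b$$ for all $u,v\colon\mathcal X\to\mathbb R$ with $u=v=g$ on $\mathcal O$. Consequently, for every $0<\omega\le1$ and every initial datum $u^0\colon\mathcal X\to\mathbb R$ with $u^0=g$ on $\mathcal O$, the iteration $$u^{m+1}(x)=(1-\omega)u^m(x)+\omega H_1[u^m](x)\ \ (x\in\mathcal U),\qquad u^{m+1}(x)=g(x)\ \ (x\in\mathcal O),$$ converges to the unique solution $u^\ast$ of $$\begin{cases}u(x)=H_1[u](x),&x\in\mathcal U,\\ u(x)=g(x),&x\in\mathcal O.\end{cases}$$ Moreover, for all $m\ge0$, $$\|u^m-u^\ast\|_b\le\Bigl(1-\frac\omega B\Bigr)^m\|u^0-u^\ast\|_b.$$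
   Context: $\mathcal G=(\mathcal X,E)$ is a finite simple undirected graph, $\mathcal O\subseteq\mathcal X$, $\mathcal U=\mathcal X\setminus\mathcal O$ (nonempty), $\mathcal N_x$ is the set of neighbors of $x$, and $d\ge1$ is an integer. For $u\colon\mathcal X\to\mathbb R$ and $x\in\mathcal U$, $$H_1[u](x)=\min_{\substack{y,z\in\mathcal N_x\\ y\ne z}}\frac{u(y)+u(z)}2.$$ The map $T_0$ is defined by $T_0[u](x)=H_1[u](x)$ for $x\in\mathcal U$ and $T_0[u](x)=g(x)$ for $x\in\mathcal O$. Barrier: $b\colon\mathcal X\to[0,\infty)$ is a fixed function with $b=0$ on $\mathcal O$, $b>0$ on $\mathcal U$, and $$\max_{\substack{y,z\in\mathcal N_x\\ y\ne z}}\frac{b(y)+b(z)}2\le b(x)-1,\qquad x\in\mathcal U.$$ Such a function exists whenever every nonempty $S\subseteq\mathcal U$ contains some $x$ with $|\mathcal N_x\cap S|\le1$. Set $B=\max_{x\in\mathcal U}b(x)$ and, for functions $w\colon\mathcal X\to\mathbb R$ vanishing on $\mathcal O$, $\|w\|_b=\max_{x\in\mathcal U}|w(x)|/b(x)$. *)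

theory Defs
  imports "HOL-Analysis.Analysis" "Graph_Theory.Pair_Digraph"
begin

text \<open>
  A finite simple undirected graph is a \<^locale>\<open>pair_graph\<close>: finite, loop-free, and with a
  symmetric arc set, an undirected edge between \<open>x\<close> and \<open>y\<close> being the two arcs \<open>(x, y)\<close> and
  \<open>(y, x)\<close>.  A function on the vertex set is a function on the whole vertex type of which only
  the values on the vertices matter.
\<close>

definition nbrs :: "'a pair_pre_digraph \<Rightarrow> 'a \<Rightarrow> 'a set" where
  "nbrs G x = {y. (x, y) \<in> parcs G}"

text \<open>
  The minimum \<open>H\<^sub>1[u](x)\<close> and the maximum in the barrier condition are taken over this set, which
  is finite, and nonempty as soon as \<open>x\<close> has two neighbours.
\<close>

definition pair_means :: "'a pair_pre_digraph \<Rightarrow> ('a \<Rightarrow> real) \<Rightarrow> 'a \<Rightarrow> real set" where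
  "pair_means G u x = {(u y + u z) / 2 | y z. y \<in> nbrs G x \<and> z \<in> nbrs G x \<and> y \<noteq> z}"

definition H1 :: "'a pair_pre_digraph \<Rightarrow> ('a \<Rightarrow> real) \<Rightarrow> 'a \<Rightarrow> real" where
  "H1 G u x = Min (pair_means G u x)"

definition T0 :: "'a pair_pre_digraph \<Rightarrow> 'a set \<Rightarrow> ('a \<Rightarrow> real) \<Rightarrow> ('a \<Rightarrow> real) \<Rightarrow> 'a \<Rightarrow> real" where
  "T0 G Ob g u x = (if x \<in> pverts G - Ob then H1 G u x else g x)"

definition is_barrier :: "'a pair_pre_digraph \<Rightarrow> 'a set \<Rightarrow> ('a \<Rightarrow> real) \<Rightarrow> bool" where
  "is_barrier G Ob b \<longleftrightarrow>
     (\<forall>x\<in>pverts G. 0 \<le> b x) \<and>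
     (\<forall>x\<in>Ob. b x = 0) \<and>
     (\<forall>x\<in>pverts G - Ob. 0 < b x) \<and>
     (\<forall>x\<in>pverts G - Ob. Max (pair_means G b x) \<le> b x - 1)"

definition bnorm :: "'a pair_pre_digraph \<Rightarrow> 'a set \<Rightarrow> ('a \<Rightarrow> real) \<Rightarrow> ('a \<Rightarrow> real) \<Rightarrow> real" where
  "bnorm G Ob b w = (MAX x\<in>pverts G - Ob. \<bar>w x\<bar> / b x)"

definition is_solution :: "'a pair_pre_digraph \<Rightarrow> 'a set \<Rightarrow> ('a \<Rightarrow> real) \<Rightarrow> ('a \<Rightarrow> real) \<Rightarrow> bool" where
  "is_solution G Ob g u \<longleftrightarrow>
     (\<forall>x\<in>pverts G - Ob. u x = H1 G u x) \<and> (\<forall>x\<in>Ob. u x = g x)"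

end

theory Submission
  imports Defs
begin

text \<open>
  A minimum of pairwise means is nonexpansive, so a deviation bounded by \<open>c b\<close> is mapped by \<open>H\<^sub>1\<close> to
  one bounded by \<open>c\<close> times the largest pairwise mean of \<open>b\<close>, that is by \<open>c (b - 1)\<close>.  Averaging
  with the identity turns this into \<open>c (b - \<omega>) \<le> c (1 - \<omega> / B) b\<close>, a contraction in the weighted
  norm.  A solution is the limit of the undamped iteration, whose increments decay geometrically;
  uniqueness and the error estimate follow from the contraction.
\<close>

text \<open>The bound \<open>two_nbrs\<close> makes \<open>pair_means\<close> nonempty at every
  interior vertex, so that the \<open>Min\<close> in \<open>H1\<close> and the \<open>Max\<close> in
  the barrier condition are attained.\<close>

locale barrier_graph = pair_graph G for G :: "'a pair_pre_digraph" +
  fixes Ob :: "'a set" and b :: "'a \<Rightarrow> real"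
  assumes Ob_subset: "Ob \<subseteq> pverts G"
    and interior_nonempty: "pverts G - Ob \<noteq> {}"
    and two_nbrs: "\<And>x. x \<in> pverts G - Ob \<Longrightarrow> 2 \<le> card (nbrs G x)"
    and is_barrier: "is_barrier G Ob b"
begin

abbreviation U where "U \<equiv> pverts G - Ob"

definition B :: real where "B = (MAX x\<in>U. b x)"

lemma finite_U: "finite U"
  by simp

section \<open>Sets of pairwise means and their minima\<close>

lemma nbrs_subset: "nbrs G x \<subseteq> pverts G"
  using wellformed by (force simp: nbrs_def)

lemma pair_means_eq_image:
  "pair_means G u x = (\<lambda>(y, z). (u y + u z) / 2) ` {(y, z). y \<in> nbrs G x \<and> z \<in> nbrs G x \<and> y \<noteq> z}"
  unfolding pair_means_def by (force simp: image_iff)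

lemma finite_pair_means: "finite (pair_means G u x)"
proof -
  have "finite (nbrs G x \<times> nbrs G x)"
    using finite_subset[OF nbrs_subset] by simp
  then have "finite {(y, z). y \<in> nbrs G x \<and> z \<in> nbrs G x \<and> y \<noteq> z}"
    by (rule rev_finite_subset) auto
  then show ?thesis
    unfolding pair_means_eq_image by (rule finite_imageI)
qed

lemma pair_means_nonempty:
  assumes "x \<in> U"
  shows "pair_means G u x \<noteq> {}"
proof -
  have "Suc (Suc 0) \<le> card (nbrs G x)"
    using two_nbrs[OF assms] by simp
  then obtain y z where "y \<in> nbrs G x" "z \<in> nbrs G x" "y \<noteq> z"
    by (force simp: card_le_Suc_iff)
  then show ?thesis
    unfolding pair_means_def by blast
qed

lemma H1_le: "y \<in> nbrs G x \<Longrightarrow> z \<in> nbrs G x \<Longrightarrow> y \<noteq> z \<Longrightarrow> H1 G u x \<le> (u y + u z) / 2"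
  unfolding H1_def by (rule Min_le[OF finite_pair_means]) (auto simp: pair_means_def)

lemma H1_attained:
  assumes "x \<in> U"
  obtains y z where "y \<in> nbrs G x" "z \<in> nbrs G x" "y \<noteq> z" "H1 G u x = (u y + u z) / 2"
proof -
  have "H1 G u x \<in> pair_means G u x"
    unfolding H1_def by (rule Min_in[OF finite_pair_means pair_means_nonempty[OF assms]])
  then show thesis
    using that by (auto simp: pair_means_def)
qed

section \<open>Barrier bounds and the weighted norm\<close>

lemma b_nonneg: "x \<in> pverts G \<Longrightarrow> 0 \<le> b x"
  and b_boundary: "x \<in> Ob \<Longrightarrow> b x = 0"
  and b_pos: "x \<in> U \<Longrightarrow> 0 < b x"
  using is_barrier unfolding is_barrier_def by auto

lemma barrier_mean_le:
  assumes "x \<in> U" "y \<in> nbrs G x" "z \<in> nbrs G x" "y \<noteq> z"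
  shows "(b y + b z) / 2 \<le> b x - 1"
proof -
  have "(b y + b z) / 2 \<le> Max (pair_means G b x)"
    using assms by (intro Max_ge[OF finite_pair_means]) (auto simp: pair_means_def)
  also have "\<dots> \<le> b x - 1"
    using is_barrier \<open>x \<in> U\<close> unfolding is_barrier_def by blast
  finally show ?thesis .
qed

lemma b_ge_1:
  assumes "x \<in> U"
  shows "1 \<le> b x"
proof -
  \<comment> \<open>Only the two distinct neighbours matter here; the function whose minimum they
    attain is arbitrary.\<close>
  obtain y z where yz: "y \<in> nbrs G x" "z \<in> nbrs G x" "y \<noteq> z"
    using H1_attained[OF assms] by metis
  then have "0 \<le> b y" "0 \<le> b z"
    using nbrs_subset b_nonneg by blast+
  then show ?thesis
    using barrier_mean_le[OF assms yz] by simp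
qed

lemma b_le_B: "x \<in> U \<Longrightarrow> b x \<le> B"
  unfolding B_def by simp

lemma B_ge_1: "1 \<le> B"
  using interior_nonempty b_ge_1 b_le_B by (metis ex_in_conv order_trans)

text \<open>Replaces the maximum by pointwise bounds without division. A negative \<open>c\<close>
  is covered: \<open>U\<close> is nonempty and \<open>b\<close> is positive there, so both sides
  fail.\<close>

lemma bnorm_le_iff: "bnorm G Ob b w \<le> c \<longleftrightarrow> (\<forall>x\<in>U. \<bar>w x\<bar> \<le> c * b x)"
  using interior_nonempty b_pos by (auto simp: bnorm_def pos_divide_le_eq)

lemma bnorm_bound: "x \<in> U \<Longrightarrow> \<bar>w x\<bar> \<le> bnorm G Ob b w * b x"
  using bnorm_le_iff by blast

lemma bnorm_nonneg: "0 \<le> bnorm G Ob b w"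
proof -
  obtain x where "x \<in> U"
    using interior_nonempty by blast
  have "0 \<le> bnorm G Ob b w * b x"
    using abs_ge_zero bnorm_bound[OF \<open>x \<in> U\<close>] by (rule order_trans)
  then show ?thesis
    using b_pos[OF \<open>x \<in> U\<close>] by (simp add: zero_le_mult_iff)
qed

section \<open>Nonexpansiveness and contraction\<close>

text \<open>The pair that attains the minimum for \<open>v\<close> competes in the minimum for
  \<open>u\<close>. On this one pair the means differ by at most \<open>c\<close> times the mean of
  \<open>b\<close>, to which the barrier inequality applies. Exchanging \<open>u\<close> and
  \<open>v\<close> gives the two-sided bound.\<close>

lemma H1_le_add:
  assumes "x \<in> U" and c: "0 \<le> c" and uv: "\<And>y. y \<in> pverts G \<Longrightarrow> \<bar>u y - v y\<bar> \<le> c * b y"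
  shows "H1 G u x \<le> H1 G v x + c * (b x - 1)"
proof -
  obtain y z where yz: "y \<in> nbrs G x" "z \<in> nbrs G x" "y \<noteq> z" and v: "H1 G v x = (v y + v z) / 2"
    using H1_attained[OF \<open>x \<in> U\<close>] by metis
  have "u y - v y \<le> c * b y" "u z - v z \<le> c * b z"
    using uv[of y] uv[of z] yz nbrs_subset by (auto simp: abs_le_iff)
  then have "(u y + u z) / 2 \<le> (v y + v z) / 2 + c * ((b y + b z) / 2)"
    by (simp add: field_simps)
  moreover have "c * ((b y + b z) / 2) \<le> c * (b x - 1)"
    using barrier_mean_le[OF \<open>x \<in> U\<close> yz] c by (rule mult_left_mono)
  ultimately show ?thesis
    using H1_le[OF yz, of u] v by linarith
qed

lemma H1_diff_le:
  assumes "x \<in> U" "0 \<le> c" "\<And>y. y \<in> pverts G \<Longrightarrow> \<bar>u y - v y\<bar> \<le> c * b y"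
  shows "\<bar>H1 G u x - H1 G v x\<bar> \<le> c * (b x - 1)"
  using H1_le_add[of x c u v] H1_le_add[of x c v u] assms
  by (auto simp: abs_le_iff abs_minus_commute)

lemma H1_cong:
  assumes "x \<in> U" "\<And>y. y \<in> pverts G \<Longrightarrow> u y = v y"
  shows "H1 G u x = H1 G v x"
  using H1_diff_le[of x 0 u v] assms by simp

text \<open>Shared estimate: \<omega> = 1 serves \<open>T0\<close> and uniqueness, general \<omega>
  the damped iteration.\<close>

lemma relaxed_step_bound:
  assumes "x \<in> U" and \<omega>: "0 \<le> \<omega>" "\<omega> \<le> 1" and Ob: "\<And>y. y \<in> Ob \<Longrightarrow> u y = v y"
  defines "c \<equiv> bnorm G Ob b (\<lambda>x. u x - v x)"
  shows "\<bar>((1 - \<omega>) * u x + \<omega> * H1 G u x) - ((1 - \<omega>) * v x + \<omega> * H1 G v x)\<bar>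
    \<le> (1 - \<omega> / B) * c * b x"
proof -
  have c: "0 \<le> c"
    unfolding c_def by (rule bnorm_nonneg)
  \<comment> \<open>The norm controls only interior vertices; on \<open>Ob\<close> the difference
    and \<open>b\<close> both vanish, so the bound extends to every vertex.\<close>
  have uv: "\<bar>u y - v y\<bar> \<le> c * b y" if "y \<in> pverts G" for y
    using that Ob[of y] b_boundary[of y] bnorm_bound[of y "\<lambda>x. u x - v x"]
    by (cases "y \<in> Ob") (auto simp: c_def)
  have "\<bar>((1 - \<omega>) * u x + \<omega> * H1 G u x) - ((1 - \<omega>) * v x + \<omega> * H1 G v x)\<bar>
      = \<bar>(1 - \<omega>) * (u x - v x) + \<omega> * (H1 G u x - H1 G v x)\<bar>"
    by (simp add: algebra_simps)
  also have "\<dots> \<le> (1 - \<omega>) * \<bar>u x - v x\<bar> + \<omega> * \<bar>H1 G u x - H1 G v x\<bar>"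
    using \<omega> by (intro order_trans[OF abs_triangle_ineq]) (simp add: abs_mult)
  also have "\<dots> \<le> (1 - \<omega>) * (c * b x) + \<omega> * (c * (b x - 1))"
    using \<omega> uv \<open>x \<in> U\<close> H1_diff_le[OF \<open>x \<in> U\<close> c uv] by (intro add_mono mult_left_mono) auto
  also have "\<dots> = c * (b x - \<omega>)"
    by (simp add: algebra_simps)
  also have "\<dots> \<le> c * (b x - \<omega> / B * b x)"
  proof (intro mult_left_mono diff_left_mono c)
    have "\<omega> * b x \<le> \<omega> * B"
      using \<omega> b_le_B[OF \<open>x \<in> U\<close>] by (intro mult_left_mono)
    then show "\<omega> / B * b x \<le> \<omega>"
      using B_ge_1 by (simp add: pos_divide_le_eq)
  qed
  finally show ?thesis
    by (simp add: algebra_simps)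
qed

lemma T0_contraction:
  assumes "\<And>y. y \<in> Ob \<Longrightarrow> u y = v y"
  shows "bnorm G Ob b (\<lambda>x. T0 G Ob g u x - T0 G Ob g v x)
    \<le> (1 - 1 / B) * bnorm G Ob b (\<lambda>x. u x - v x)"
  unfolding bnorm_le_iff using relaxed_step_bound[of _ 1 u v] assms by (auto simp: T0_def)

lemma contraction_factor:
  assumes "0 < \<omega>" "\<omega> \<le> 1"
  shows "0 \<le> 1 - \<omega> / B" "1 - \<omega> / B < 1"
  using assms B_ge_1 by (auto simp: field_simps)

section \<open>Uniqueness and existence of the solution\<close>

text \<open>Solutions are fixed by the step with \<omega> = 1, so their distance \<open>N\<close>
  satisfies \<open>N \<le> (1 - 1 / B) * N\<close>, which forces \<open>N \<le> 0\<close>.\<close>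

lemma solution_unique:
  assumes "is_solution G Ob g u" "is_solution G Ob g v" "x \<in> pverts G"
  shows "u x = v x"
proof (cases "x \<in> Ob")
  case True
  then show ?thesis
    using assms by (simp add: is_solution_def)
next
  case False
  define N where "N = bnorm G Ob b (\<lambda>x. u x - v x)"
  have "N \<le> (1 - 1 / B) * N"
    using relaxed_step_bound[of _ 1 u v] assms
    unfolding N_def by (subst bnorm_le_iff) (auto simp: is_solution_def)
  then have "N / B \<le> 0"
    by (simp add: algebra_simps)
  then have "N \<le> 0"
    using B_ge_1 by (simp add: divide_le_0_iff)
  then have "N * b x \<le> 0"
    using b_nonneg[OF \<open>x \<in> pverts G\<close>] by (simp add: mult_nonpos_nonneg)
  then show ?thesis
    using bnorm_bound[of x "\<lambda>x. u x - v x"] False \<open>x \<in> pverts G\<close> by (simp add: N_def)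
qed

text \<open>Continuity of \<open>H1\<close> under pointwise convergence, needed to pass to the limit
  in the fixed point equation. Finiteness of \<open>U\<close> makes the pointwise bounds hold
  simultaneously; exact agreement on \<open>Ob\<close> is required because \<open>c * b\<close> is
  zero there.\<close>

lemma tendsto_H1:
  fixes u :: "'c \<Rightarrow> 'a \<Rightarrow> real"
  assumes "x \<in> U" and lim: "\<And>y. y \<in> U \<Longrightarrow> ((\<lambda>m. u m y) \<longlongrightarrow> l y) F"
    and Ob: "\<And>m y. y \<in> Ob \<Longrightarrow> u m y = l y"
  shows "((\<lambda>m. H1 G (u m) x) \<longlongrightarrow> H1 G l x) F"
proof (rule tendstoI)
  fix e :: real
  assume "0 < e"
  \<comment> \<open>Chosen so that \<open>c * b x = e\<close>; the gain from \<open>b x\<close> to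
    \<open>b x - 1\<close> then yields the strict inequality.\<close>
  define c where "c = e / b x"
  have "0 < c"
    using \<open>0 < e\<close> b_pos[OF \<open>x \<in> U\<close>] by (simp add: c_def)
  have "\<forall>y\<in>U. eventually (\<lambda>m. dist (u m y) (l y) < c * b y) F"
    using lim b_pos \<open>0 < c\<close> by (intro ballI tendstoD) auto
  then have "eventually (\<lambda>m. \<forall>y\<in>U. dist (u m y) (l y) < c * b y) F"
    by (rule eventually_ball_finite[OF finite_U])
  then show "eventually (\<lambda>m. dist (H1 G (u m) x) (H1 G l x) < e) F"
  proof eventually_elim
    case (elim m)
    have "\<bar>u m y - l y\<bar> \<le> c * b y" if "y \<in> pverts G" for y
      using that elim Ob[of y m] b_boundary[of y]
      by (cases "y \<in> Ob") (auto simp: dist_real_def intro: less_imp_le)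
    then have "\<bar>H1 G (u m) x - H1 G l x\<bar> \<le> c * (b x - 1)"
      using \<open>x \<in> U\<close> \<open>0 < c\<close> by (intro H1_diff_le) auto
    also have "\<dots> < c * b x"
      using \<open>0 < c\<close> by simp
    also have "\<dots> = e"
      using b_pos[OF \<open>x \<in> U\<close>] by (simp add: c_def)
    finally show ?case
      by (simp add: dist_real_def)
  qed
qed

lemma solution_exists: "\<exists>u. is_solution G Ob g u"
proof -
  \<comment> \<open>Starting from \<open>g\<close> gives the correct boundary values already at
    index 0.\<close>
  define u where "u m = (T0 G Ob g ^^ m) g" for m
  have u_Suc: "u (Suc m) = T0 G Ob g (u m)" for m
    by (simp add: u_def)
  have u_Ob: "u m x = g x" if "x \<in> Ob" for m x
    using that by (cases m) (auto simp: u_def T0_def)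
  define q where "q = 1 - 1 / B"
  define N where "N m = bnorm G Ob b (\<lambda>x. u (Suc m) x - u m x)" for m
  have q: "0 \<le> q" "q < 1"
    using contraction_factor[of 1] by (auto simp: q_def)
  have N: "N m \<le> q ^ m * N 0" for m
  proof (induction m)
    case (Suc m)
    have "N (Suc m) \<le> q * N m"
      unfolding N_def q_def u_Suc[of "Suc m"]
      \<comment> \<open>Only the subtracted \<open>u (Suc m)\<close> is unfolded: both terms become
        images under \<open>T0\<close>, while the right-hand side keeps its form.\<close>
      by (subst (2) u_Suc) (rule T0_contraction, simp add: u_Ob)
    also have "\<dots> \<le> q * (q ^ m * N 0)"
      using Suc q by (intro mult_left_mono)
    finally show ?case
      by simp
  qed simp
  have conv: "convergent (\<lambda>m. u m x)" if "x \<in> U" for x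
  proof -
    have "\<bar>u (Suc m) x - u m x\<bar> \<le> q ^ m * N 0 * b x" for m
    proof (rule order_trans)
      show "\<bar>u (Suc m) x - u m x\<bar> \<le> N m * b x"
        unfolding N_def by (rule bnorm_bound[OF that])
      show "N m * b x \<le> q ^ m * N 0 * b x"
        using N b_pos[OF that] by (intro mult_right_mono) auto
    qed
    moreover have "summable (\<lambda>m. q ^ m * N 0 * b x)"
      using summable_mult2[OF summable_mult2[OF summable_geometric[of q]]] q by simp
    \<comment> \<open>Completeness enters pointwise: the increments are dominated by a geometric
      series, and their partial sums telescope to \<open>u n x - u 0 x\<close>.\<close>
    ultimately have "summable (\<lambda>m. u (Suc m) x - u m x)"
      by (metis (no_types, lifting) real_norm_def summable_comparison_test')
    then have "convergent (\<lambda>n. \<Sum>m<n. u (Suc m) x - u m x)"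
      by (simp add: summable_iff_convergent)
    then have "convergent (\<lambda>n. u n x - u 0 x)"
      by (simp only: sum_lessThan_telescope[of "\<lambda>m. u m x"])
    from convergent_add[OF this convergent_const[of "u 0 x"]] show ?thesis
      by simp
  qed
  define l where "l x = (if x \<in> Ob then g x else lim (\<lambda>m. u m x))" for x
  have lim: "(\<lambda>m. u m x) \<longlonglongrightarrow> l x" if "x \<in> U" for x
    using conv[OF that, unfolded convergent_LIMSEQ_iff] that by (simp add: l_def)
  \<comment> \<open>Both sides are limits of the shifted sequence
    \<open>u (Suc m) x\<close>.\<close>
  have "l x = H1 G l x" if "x \<in> U" for x
  proof (rule LIMSEQ_unique)
    show "(\<lambda>m. u (Suc m) x) \<longlonglongrightarrow> l x"
      using lim[OF that] by (rule LIMSEQ_Suc)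
    have "(\<lambda>m. H1 G (u m) x) \<longlonglongrightarrow> H1 G l x"
      using lim that by (intro tendsto_H1) (auto simp: u_Ob l_def)
    then show "(\<lambda>m. u (Suc m) x) \<longlonglongrightarrow> H1 G l x"
      using that by (simp add: u_Suc T0_def)
  qed
  moreover have "l x = g x" if "x \<in> Ob" for x
    using that by (simp add: l_def)
  ultimately have "is_solution G Ob g l"
    unfolding is_solution_def by blast
  then show ?thesis
    by blast
qed

text \<open>\<open>is_solution\<close> leaves values outside the vertex set free, so uniqueness as a
  function needs the normalization by \<open>extensional\<close>. Restriction preserves solutions
  because \<open>H1\<close> at an interior vertex reads values at vertices only.\<close>

lemma solution_ex1: "\<exists>!u. u \<in> extensional (pverts G) \<and> is_solution G Ob g u"
proof (rule ex_ex1I)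
  obtain u where u: "is_solution G Ob g u"
    using solution_exists by blast
  have "H1 G (restrict u (pverts G)) x = H1 G u x" if "x \<in> U" for x
    using that by (intro H1_cong) auto
  then have "is_solution G Ob g (restrict u (pverts G))"
    using u Ob_subset unfolding is_solution_def by auto
  then show "\<exists>u. u \<in> extensional (pverts G) \<and> is_solution G Ob g u"
    by blast
next
  fix u v
  assume "u \<in> extensional (pverts G) \<and> is_solution G Ob g u"
    "v \<in> extensional (pverts G) \<and> is_solution G Ob g v"
  then show "u = v"
    using solution_unique by (blast intro: extensionalityI)
qed

section \<open>Convergence rate of the damped iteration\<close>

context
  fixes g us :: "'a \<Rightarrow> real" and \<omega> :: real and u :: "nat \<Rightarrow> 'a \<Rightarrow> real"
  assumes sol: "is_solution G Ob g us"
    and \<omega>: "0 < \<omega>" "\<omega> \<le> 1"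
    and iter: "\<And>m x. x \<in> U \<Longrightarrow> u (Suc m) x = (1 - \<omega>) * u m x + \<omega> * H1 G (u m) x"
    and boundary: "\<And>m x. x \<in> Ob \<Longrightarrow> u m x = g x"
begin

text \<open>A solution is fixed by the relaxed step for every \<omega>, so each new error is a
  difference of two images of that step and shrinks by the factor
  \<open>1 - \<omega> / B\<close>.\<close>

lemma iteration_error:
  "bnorm G Ob b (\<lambda>x. u m x - us x) \<le> (1 - \<omega> / B) ^ m * bnorm G Ob b (\<lambda>x. u 0 x - us x)"
proof (induction m)
  case (Suc m)
  define e where "e n = bnorm G Ob b (\<lambda>x. u n x - us x)" for n
  have "e (Suc m) \<le> (1 - \<omega> / B) * e m"
    unfolding e_def bnorm_le_iff
  proof
    fix x
    assume "x \<in> U"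
    have us_step: "(1 - \<omega>) * us x + \<omega> * H1 G us x = us x"
      using sol \<open>x \<in> U\<close> by (simp add: is_solution_def algebra_simps)
    have "u m y = us y" if "y \<in> Ob" for y
      using sol boundary that by (simp add: is_solution_def)
    then show "\<bar>u (Suc m) x - us x\<bar> \<le> (1 - \<omega> / B) * bnorm G Ob b (\<lambda>x. u m x - us x) * b x"
      using relaxed_step_bound[OF \<open>x \<in> U\<close>, of \<omega> "u m" us] \<omega>
      unfolding us_step iter[OF \<open>x \<in> U\<close>] by simp
  qed
  also have "\<dots> \<le> (1 - \<omega> / B) * ((1 - \<omega> / B) ^ m * e 0)"
    using Suc contraction_factor[OF \<omega>] by (intro mult_left_mono) (auto simp: e_def)
  finally show ?case
    by (simp add: e_def)
qed simp

text \<open>On \<open>Ob\<close> the sequence is constant; at an interior vertex the error estimate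
  bounds it by a geometric null sequence.\<close>

lemma iteration_converges:
  assumes "x \<in> pverts G"
  shows "(\<lambda>m. u m x) \<longlonglongrightarrow> us x"
proof (cases "x \<in> Ob")
  case True
  then show ?thesis
    using sol by (simp add: boundary is_solution_def)
next
  case False
  then have "x \<in> U"
    using assms by simp
  define e where "e n = bnorm G Ob b (\<lambda>x. u n x - us x)" for n
  have "\<bar>u m x - us x\<bar> \<le> (1 - \<omega> / B) ^ m * (e 0 * b x)" for m
  proof -
    have "\<bar>u m x - us x\<bar> \<le> e m * b x"
      unfolding e_def by (rule bnorm_bound[OF \<open>x \<in> U\<close>])
    also have "\<dots> \<le> (1 - \<omega> / B) ^ m * e 0 * b x"
      unfolding e_def
      by (rule mult_right_mono[OF iteration_error less_imp_le[OF b_pos[OF \<open>x \<in> U\<close>]]])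
    finally show ?thesis
      by (simp add: mult.assoc)
  qed
  moreover have "(\<lambda>m. (1 - \<omega> / B) ^ m * (e 0 * b x)) \<longlonglongrightarrow> 0"
    using contraction_factor[OF \<omega>] by (intro tendsto_mult_left_zero LIMSEQ_realpow_zero)
  ultimately have "(\<lambda>m. u m x - us x) \<longlonglongrightarrow> 0"
    by (metis (no_types, lifting) real_norm_def always_eventually Lim_null_comparison)
  then show ?thesis
    by (simp add: LIM_zero_iff)
qed

end

end

theorem theorem6p6:
  fixes G :: "'a pair_pre_digraph" and Ob U :: "'a set" and d :: nat
    and g b :: "'a \<Rightarrow> real" and B :: real
  assumes graph: "pair_graph G"
    and Ob: "Ob \<subseteq> pverts G"
    and U: "U = pverts G - Ob"
    and U_nonempty: "U \<noteq> {}"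
    and d: "d \<ge> 1"
    and peeling: "\<And>S. S \<subseteq> U \<Longrightarrow> S \<noteq> {} \<Longrightarrow> \<exists>x\<in>S. card (nbrs G x \<inter> S) \<le> 1"
    and degree: "\<And>x. x \<in> U \<Longrightarrow> card (nbrs G x) = 2 * d"
    and barrier: "is_barrier G Ob b"
    and B: "B = (MAX x\<in>U. b x)"
  shows
    "(\<forall>u v. (\<forall>x\<in>Ob. u x = g x) \<and> (\<forall>x\<in>Ob. v x = g x) \<longrightarrow>
        bnorm G Ob b (\<lambda>x. T0 G Ob g u x - T0 G Ob g v x)
          \<le> (1 - 1 / B) * bnorm G Ob b (\<lambda>x. u x - v x))
     \<and> (\<exists>!us. us \<in> extensional (pverts G) \<and> is_solution G Ob g us)
     \<and> (\<forall>us \<omega> u. is_solution G Ob g us \<longrightarrow> 0 < \<omega> \<longrightarrow> \<omega> \<le> 1 \<longrightarrow>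
          (\<forall>x\<in>Ob. u 0 x = g x) \<longrightarrow>
          (\<forall>m. \<forall>x\<in>U. u (Suc m) x = (1 - \<omega>) * u m x + \<omega> * H1 G (u m) x) \<longrightarrow>
          (\<forall>m. \<forall>x\<in>Ob. u (Suc m) x = g x) \<longrightarrow>
            (\<forall>x\<in>pverts G. (\<lambda>m. u m x) \<longlonglongrightarrow> us x)
          \<and> (\<forall>m. bnorm G Ob b (\<lambda>x. u m x - us x)
                  \<le> (1 - \<omega> / B) ^ m * bnorm G Ob b (\<lambda>x. u 0 x - us x)))"
proof -
  interpret pair_graph G
    by (rule graph)
  \<comment> \<open>Since \<open>d \<ge> 1\<close>, the degree \<open>2 * d\<close> provides the two
    neighbours.\<close>
  interpret barrier_graph G Ob b
    using Ob U_nonempty U d degree barrier by unfold_locales auto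
  \<comment> \<open>Identifies the variable \<open>B\<close> of the statement with the constant of
    the locale, in terms of which the estimates are proved.\<close>
  have B_eq: "B = barrier_graph.B G Ob b"
    by (simp add: B U B_def)
  show ?thesis
  proof (intro conjI allI impI)
    fix u v :: "'a \<Rightarrow> real"
    assume "(\<forall>x\<in>Ob. u x = g x) \<and> (\<forall>x\<in>Ob. v x = g x)"
    then show "bnorm G Ob b (\<lambda>x. T0 G Ob g u x - T0 G Ob g v x)
        \<le> (1 - 1 / B) * bnorm G Ob b (\<lambda>x. u x - v x)"
      unfolding B_eq by (intro T0_contraction) simp
  next
    show "\<exists>!us. us \<in> extensional (pverts G) \<and> is_solution G Ob g us"
      by (rule solution_ex1)
  next
    fix us \<omega> and u :: "nat \<Rightarrow> 'a \<Rightarrow> real"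
    assume sol: "is_solution G Ob g us" and \<omega>: "0 < \<omega>" "\<omega> \<le> 1"
      and init: "\<forall>x\<in>Ob. u 0 x = g x"
      and iter: "\<forall>m. \<forall>x\<in>U. u (Suc m) x = (1 - \<omega>) * u m x + \<omega> * H1 G (u m) x"
      and boundary: "\<forall>m. \<forall>x\<in>Ob. u (Suc m) x = g x"
    \<comment> \<open>Index 0 comes from the initial datum, later indices from the boundary rule of
      the iteration.\<close>
    have boundary': "u m x = g x" if "x \<in> Ob" for m x
      using that init boundary by (cases m) auto
    have iter': "u (Suc m) x = (1 - \<omega>) * u m x + \<omega> * H1 G (u m) x" if "x \<in> pverts G - Ob" for m x
      using that iter U by blast
    show "\<forall>x\<in>pverts G. (\<lambda>m. u m x) \<longlonglongrightarrow> us x"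
      using iteration_converges[where u = u, OF sol \<omega> iter' boundary'] by blast
    show "bnorm G Ob b (\<lambda>x. u m x - us x)
        \<le> (1 - \<omega> / B) ^ m * bnorm G Ob b (\<lambda>x. u 0 x - us x)" for m
      unfolding B_eq by (rule iteration_error[where u = u, OF sol \<omega> iter' boundary'])
  qed
qed

end
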